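(* Let $r$ be a positive integer and let $m,n$ be non-negative integers. The box polynomial $B_{m,n}(x)$ evaluated at $x=r$ equals the number of set partitions of $\{1,2,\ldots,m+n+r\}$ into $n+r$ blocks such that the elements $1,2,\ldots,r$ are all in different blocks.
   Context: For non-negative integers $m,n$, the box polynomial is $$B_{m,n}(x)=\sum_{\lambda\subseteq m\times n}\ \prod_{i=1}^{m}(x+\lambda_i),$$ where the sum is over all integer sequences (partitions) $\lambda=(n\ge\lambda_1\ge\lambda_2\ge\cdots\ge\lambda_m\ge 0)$, i.e. partitions with $m$ non-negative parts, each at most $n$ (an empty product is $1$). The blocks of a set partition are non-empty. *)

theory Defs
  imports "HOL-Computational_Algebra.Polynomial" "HOL-Library.Disjoint_Sets"
begin

(* Parts are indexed from 0: the list entry ls ! i is the part lambda_(i+1). *)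
definition box_partitions :: "nat \<Rightarrow> nat \<Rightarrow> nat list set" where
  "box_partitions m n = {ls. length ls = m \<and> sorted_wrt (\<ge>) ls \<and> (\<forall>k\<in>set ls. k \<le> n)}"

lemma finite_box_partitions: "finite (box_partitions m n)"
proof (rule finite_subset)
  show "box_partitions m n \<subseteq> {ls. set ls \<subseteq> {..n} \<and> length ls = m}"
    by (auto simp: box_partitions_def)
  show "finite {ls. set ls \<subseteq> {..n} \<and> length ls = m}"
    by (rule finite_lists_length_eq) simp
qed

(* [:c, 1:] is the linear polynomial x + c. *)
definition box_poly :: "nat \<Rightarrow> nat \<Rightarrow> int poly" where
  "box_poly m n = (\<Sum>ls\<in>box_partitions m n. \<Prod>i<m. [:int (ls ! i), 1:])"

definition separated_partitions :: "nat \<Rightarrow> nat \<Rightarrow> nat \<Rightarrow> nat set set set" where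
  "separated_partitions N k r =
     {P. partition_on {1..N} P \<and> card P = k \<and>
         (\<forall>i\<in>{1..r}. \<forall>j\<in>{1..r}. i \<noteq> j \<longrightarrow> \<not> (\<exists>B\<in>P. i \<in> B \<and> j \<in> B))}"

lemma finite_separated_partitions: "finite (separated_partitions N k r)"
proof (rule finite_subset)
  show "separated_partitions N k r \<subseteq> Pow (Pow {1..N})"
    by (auto simp: separated_partitions_def partition_on_def)
qed simp

end

(* Both sides satisfy F(m,n) = (r + n) F(m-1,n) + F(m,n-1). For the box polynomial, distinguish
   whether the largest part equals n or is smaller; for the set partitions, whether the element
   m+n+r shares its block with other elements or forms a singleton. *)

theory Submission
  imports Defs
begin

section \<open>Recurrence of the box polynomial\<close>

lemma box_partitions_0: "box_partitions 0 n = {[]}"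
  by (auto simp: box_partitions_def)

lemma box_partitions_Suc_0: "box_partitions (Suc m) 0 = (#) 0 ` box_partitions m 0"
  by (auto simp: box_partitions_def length_Suc_conv image_iff)

text \<open>The list is weakly decreasing, so its head bounds all other entries: a head
  \<open>Suc n\<close> leaves the tail free up to \<open>Suc n\<close>, and any smaller head forces
  every entry to be at most \<open>n\<close>.\<close>

lemma box_partitions_Suc_Suc:
  "box_partitions (Suc m) (Suc n) = (#) (Suc n) ` box_partitions m (Suc n) \<union> box_partitions (Suc m) n"
proof (intro equalityI subsetI)
  fix ls assume "ls \<in> box_partitions (Suc m) (Suc n)"
  then obtain k ks where ls: "ls = k # ks" "length ks = m" "sorted_wrt (\<ge>) ks" "k \<le> Suc n"
    and ks: "\<forall>j\<in>set ks. j \<le> k"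
    by (auto simp: box_partitions_def length_Suc_conv)
  show "ls \<in> (#) (Suc n) ` box_partitions m (Suc n) \<union> box_partitions (Suc m) n"
  proof (cases "k = Suc n")
    case True
    with ls ks show ?thesis by (auto simp: box_partitions_def)
  next
    case False
    with ls ks show ?thesis by (fastforce simp: box_partitions_def)
  qed
qed (auto simp: box_partitions_def)

text \<open>Prepending \<open>k\<close> moves every other entry up by one index, so the factor at
  index 0 is the same for all lists and can be pulled out of the sum.\<close>

lemma sum_prod_Cons:
  "(\<Sum>ls\<in>(#) k ` S. \<Prod>i<Suc m. [:int (ls ! i), 1:]) = [:int k, 1:] * (\<Sum>ls\<in>S. \<Prod>i<m. [:int (ls ! i), 1:])"
  by (subst sum.reindex) (simp_all del: mult_pCons_left prod.lessThan_Suc add: prod.lessThan_Suc_shift sum_distrib_left)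

lemma box_poly_0: "box_poly 0 n = 1"
  by (simp add: box_poly_def box_partitions_0)

lemma box_poly_Suc_0: "box_poly (Suc m) 0 = [:0, 1:] * box_poly m 0"
  unfolding box_poly_def box_partitions_Suc_0 sum_prod_Cons by simp

lemma box_poly_Suc_Suc:
  "box_poly (Suc m) (Suc n) = [:int (Suc n), 1:] * box_poly m (Suc n) + box_poly (Suc m) n"
  unfolding box_poly_def box_partitions_Suc_Suc
  \<comment> \<open>The two families are disjoint: lists of the first contain \<open>Suc n\<close>,
    those of the second have entries at most \<open>n\<close>.\<close>
  by (subst sum.union_disjoint)
    (simp_all only: sum_prod_Cons finite_box_partitions finite_imageI, auto simp: box_partitions_def)

section \<open>Set partitions whose blocks meet a given set in at most one element\<close>

definition separating_partitions :: "'a set \<Rightarrow> 'a set \<Rightarrow> nat \<Rightarrow> 'a set set set" where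
  "separating_partitions R A k =
     {P. partition_on A P \<and> card P = k \<and> (\<forall>B\<in>P. \<forall>i\<in>R \<inter> B. \<forall>j\<in>R \<inter> B. i = j)}"

text \<open>Passes from initial intervals to arbitrary sets, where a single fresh element can be
  added or removed. The cardinalities are the r-Stirling numbers of the second kind.\<close>

lemma separated_partitions_eq: "separated_partitions N k r = separating_partitions {1..r} {1..N} k"
  unfolding separated_partitions_def separating_partitions_def by blast

lemma finite_separating_partitions: "finite A \<Longrightarrow> finite (separating_partitions R A k)"
  by (rule finite_subset[OF _ finitely_many_partition_on]) (auto simp: separating_partitions_def)

lemma separating_partitions_empty_if_gt:
  assumes "finite A" "card A < k"
  shows "separating_partitions R A k = {}"
proof -
  have "card P \<le> card A" if P: "partition_on A P" for P
  proof -
    have fin: "finite B" "B \<noteq> {}" if "B \<in> P" for B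
      using that P assms(1) by (auto simp: partition_on_def intro: finite_subset)
    have "card P = (\<Sum>B\<in>P. 1)" by simp
    also have "\<dots> \<le> (\<Sum>B\<in>P. card B)"
      by (intro sum_mono) (use fin in \<open>simp add: Suc_le_eq card_gt_0_iff\<close>)
    also have "\<dots> = card A" using product_partition[OF P] fin by simp
    finally show ?thesis .
  qed
  with assms(2) show ?thesis by (fastforce simp: separating_partitions_def)
qed

text \<open>Pigeonhole: sending each element of \<open>R\<close> to a block containing it is
  injective, because no block holds two elements of \<open>R\<close>.\<close>

lemma separating_partitions_empty_if_less:
  assumes "finite A" "R \<subseteq> A" "k < card R"
  shows "separating_partitions R A k = {}"
proof (rule equals0I)
  fix P assume "P \<in> separating_partitions R A k"
  then have P: "\<Union>P = A" "finite P" "card P = k"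
    and sep: "\<forall>B\<in>P. \<forall>i\<in>R \<inter> B. \<forall>j\<in>R \<inter> B. i = j"
    using finite_elements[OF assms(1)] by (auto simp: separating_partitions_def partition_on_def)
  from P(1) assms(2) have "\<forall>i\<in>R. \<exists>B\<in>P. i \<in> B" by blast
  then obtain f where f: "\<And>i. i \<in> R \<Longrightarrow> f i \<in> P" "\<And>i. i \<in> R \<Longrightarrow> i \<in> f i"
    by metis
  have "inj_on f R"
  proof (rule inj_onI)
    fix i j assume "i \<in> R" "j \<in> R" "f i = f j"
    with f[of i] f[of j] sep show "i = j" by blast
  qed
  moreover have "f ` R \<subseteq> P" using f(1) by blast
  ultimately have "card R \<le> card P" using P(2) by (rule card_inj_on_le)
  with P(3) assms(3) show False by simp
qed

text \<open>Every block lies inside \<open>R\<close> and may contain only one element of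
  \<open>R\<close>, so it is a singleton.\<close>

lemma separating_partitions_self: "separating_partitions R R (card R) = {(\<lambda>x. {x}) ` R}"
proof (intro equalityI subsetI)
  fix P assume "P \<in> separating_partitions R R (card R)"
  then have P: "\<Union>P = R" "{} \<notin> P" and sep: "\<forall>B\<in>P. \<forall>i\<in>R \<inter> B. \<forall>j\<in>R \<inter> B. i = j"
    by (auto simp: separating_partitions_def partition_on_def)
  have single: "B = {x}" if "B \<in> P" "x \<in> B" for B x
    using that P(1) sep by blast
  have "P = (\<lambda>x. {x}) ` R"
  proof (intro equalityI subsetI)
    fix B assume "B \<in> P"
    with P obtain x where "x \<in> B" by fastforce
    with \<open>B \<in> P\<close> P single show "B \<in> (\<lambda>x. {x}) ` R" by blast
  next
    fix B assume "B \<in> (\<lambda>x. {x}) ` R"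
    with P single show "B \<in> P" by blast
  qed
  then show "P \<in> {(\<lambda>x. {x}) ` R}" by simp
qed (auto simp: separating_partitions_def partition_on_singletons card_image inj_on_def)

section \<open>Changing a single block and counting the ways to insert an element\<close>

lemma partition_on_remove_block:
  assumes "partition_on A P" "B \<in> P"
  shows "partition_on (A - B) (P - {B})"
proof -
  have "disjnt B (\<Union>(P - {B}))"
    using assms by (auto simp: partition_on_def pairwise_def disjnt_def)
  from partition_on_insert[OF this, of A] assms show ?thesis
    by (simp add: insert_absorb)
qed

lemma partition_on_add_block:
  assumes "partition_on A P" "C \<noteq> {}" "C \<inter> A = {}"
  shows "partition_on (C \<union> A) (insert C P)"
proof -
  have "disjnt C (\<Union>P)" "C \<union> A - C = A"
    using assms by (auto simp: partition_on_def disjnt_def)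
  with partition_on_insert[of C P "C \<union> A"] assms show ?thesis by simp
qed

lemma partition_on_extend_block:
  assumes "a \<notin> A" "partition_on A P" "B \<in> P"
  shows "partition_on (insert a A) (insert (insert a B) (P - {B}))"
proof -
  have "B \<subseteq> A" using assms by (auto simp: partition_on_def)
  then have "insert a B \<union> (A - B) = insert a A" by auto
  with partition_on_add_block[OF partition_on_remove_block[OF assms(2,3)], of "insert a B"] assms(1)
  show ?thesis by auto
qed

text \<open>Remove \<open>C\<close>, then add back \<open>C - {a}\<close>; the assumption
  \<open>C \<noteq> {a}\<close> keeps the new block non-empty.\<close>

lemma partition_on_shrink_block:
  assumes "a \<notin> A" "partition_on (insert a A) Q" "C \<in> Q" "a \<in> C" "C \<noteq> {a}"
  shows "partition_on A (insert (C - {a}) (Q - {C}))"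
proof -
  have "C \<subseteq> insert a A" using assms by (auto simp: partition_on_def)
  then have "(C - {a}) \<union> (insert a A - C) = A" "C - {a} \<noteq> {}" using assms by auto
  with partition_on_add_block[OF partition_on_remove_block[OF assms(2,3)], of "C - {a}"]
  show ?thesis by auto
qed

text \<open>Delete \<open>a\<close>: if \<open>{a}\<close> is a block, \<open>k\<close> blocks
  remain on \<open>A\<close>; otherwise \<open>Suc k\<close> blocks remain, and \<open>a\<close> may
  have come from any of them. Since \<open>a\<close> is outside \<open>R\<close>, separation is
  unaffected.\<close>

lemma card_separating_partitions_insert:
  assumes fin: "finite A" and a: "a \<notin> A" and R: "R \<subseteq> A"
  shows "card (separating_partitions R (insert a A) (Suc k)) =
         card (separating_partitions R A k) + Suc k * card (separating_partitions R A (Suc k))"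
proof -
  \<comment> \<open>Pairs of a partition of \<open>A\<close> and the block chosen to receive
    \<open>a\<close>; \<open>extend\<close> performs the insertion.\<close>
  define U where "U = Sigma (separating_partitions R A (Suc k)) (\<lambda>P. P)"
  define extend where "extend = (\<lambda>(P, B). insert (insert a B) (P - {B}))"
  have finP: "finite P" if "partition_on A P" for P
    using that fin finite_elements by blast
  have notin: "a \<notin> B" if "partition_on A P" "B \<in> P" for P B
    using that a by (auto simp: partition_on_def)
  have split: "separating_partitions R (insert a A) (Suc k) =
      insert {a} ` separating_partitions R A k \<union> extend ` U"
  proof (intro equalityI subsetI)
    fix Q assume Q: "Q \<in> separating_partitions R (insert a A) (Suc k)"
    then have part: "partition_on (insert a A) Q" and card: "card Q = Suc k"
      and sep: "\<forall>B\<in>Q. \<forall>i\<in>R \<inter> B. \<forall>j\<in>R \<inter> B. i = j"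
      by (auto simp: separating_partitions_def)
    \<comment> \<open>An infinite set has \<open>card\<close> 0, so a positive value forces
      finiteness.\<close>
    have finQ: "finite Q" using card card.infinite by fastforce
    from part obtain C where C: "C \<in> Q" "a \<in> C" by (auto simp: partition_on_def)
    show "Q \<in> insert {a} ` separating_partitions R A k \<union> extend ` U"
    proof (cases "C = {a}")
      case True
      have "insert {a} (Q - {{a}}) = Q" using C True by auto
      then have "partition_on A (Q - {{a}})"
        using partition_on_remove_block[OF part C(1)] True a by simp
      then have "Q - {{a}} \<in> separating_partitions R A k"
        using C True card sep finQ by (auto simp: separating_partitions_def)
      with \<open>insert {a} (Q - {{a}}) = Q\<close> show ?thesis by (metis UnI1 imageI)
    next
      case False
      define P where "P = insert (C - {a}) (Q - {C})"
      have partP: "partition_on A P"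
        unfolding P_def using partition_on_shrink_block[OF a part C False] .
      \<comment> \<open>The shrunken block must be new, so that replacing \<open>C\<close> by it
        keeps the number of blocks. Were it in \<open>Q\<close>, it would be disjoint from
        \<open>C\<close> and hence empty.\<close>
      have new: "C - {a} \<notin> Q"
      proof
        assume "C - {a} \<in> Q"
        moreover have "C - {a} \<noteq> C" using C by auto
        ultimately have "disjnt (C - {a}) C"
          using part C by (auto simp: partition_on_def pairwise_def)
        then have "C - {a} = {}" unfolding disjnt_def by blast
        with C False show False by blast
      qed
      have "card P = Suc k"
        using new finQ C card by (simp add: P_def card.insert_remove)
      moreover have "\<forall>B\<in>P. \<forall>i\<in>R \<inter> B. \<forall>j\<in>R \<inter> B. i = j"
        using sep C by (auto simp: P_def)
      ultimately have "(P, C - {a}) \<in> U"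
        using partP by (auto simp: U_def separating_partitions_def P_def)
      moreover have "extend (P, C - {a}) = Q"
        using C new by (auto simp: extend_def P_def insert_absorb)
      ultimately show ?thesis by (metis UnI2 imageI)
    qed
  next
    fix Q assume "Q \<in> insert {a} ` separating_partitions R A k \<union> extend ` U"
    then show "Q \<in> separating_partitions R (insert a A) (Suc k)"
    proof
      assume "Q \<in> insert {a} ` separating_partitions R A k"
      then obtain P where P: "P \<in> separating_partitions R A k" and Q: "Q = insert {a} P" by auto
      then have part: "partition_on A P" by (simp add: separating_partitions_def)
      have "partition_on (insert a A) Q"
        using partition_on_add_block[OF part, of "{a}"] a by (simp add: Q)
      moreover have "{a} \<notin> P" using notin[OF part] by blast
      ultimately show ?thesis
        using P a R finP[OF part] by (auto simp: Q separating_partitions_def)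
    next
      assume "Q \<in> extend ` U"
      then obtain P B where P: "P \<in> separating_partitions R A (Suc k)" "B \<in> P"
        and Q: "Q = insert (insert a B) (P - {B})" by (auto simp: U_def extend_def)
      then have part: "partition_on A P" and card: "card P = Suc k"
        and sep: "\<forall>B\<in>P. \<forall>i\<in>R \<inter> B. \<forall>j\<in>R \<inter> B. i = j"
        by (auto simp: separating_partitions_def)
      have "insert a B \<notin> P" using notin[OF part] by blast
      then have "card Q = Suc k"
        using finP[OF part] card P by (simp add: Q card.insert_remove)
      moreover have "partition_on (insert a A) Q"
        unfolding Q using partition_on_extend_block[OF a part P(2)] .
      moreover have "\<forall>B\<in>Q. \<forall>i\<in>R \<inter> B. \<forall>j\<in>R \<inter> B. i = j"
        using sep P a R by (auto simp: Q)
      ultimately show ?thesis by (simp add: separating_partitions_def)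
    qed
  qed
  have disj: "insert {a} ` separating_partitions R A k \<inter> extend ` U = {}"
  proof -
    \<comment> \<open>The block of \<open>a\<close> in an extended partition also contains the
      non-empty \<open>B\<close>.\<close>
    have "{a} \<notin> extend (P, B)" if "(P, B) \<in> U" for P B
    proof -
      from that have part: "partition_on A P" "B \<in> P" by (auto simp: U_def separating_partitions_def)
      then have "B \<noteq> {}" by (auto simp: partition_on_def)
      with notin[OF part] notin[OF part(1)] show ?thesis by (auto simp: extend_def)
    qed
    then show ?thesis by auto
  qed
  have inj1: "inj_on (insert {a}) (separating_partitions R A k)"
  proof (rule inj_onI)
    fix P P' assume "P \<in> separating_partitions R A k" "P' \<in> separating_partitions R A k"
      and eq: "insert {a} P = insert {a} P'"
    then have "{a} \<notin> P" "{a} \<notin> P'" using notin by (auto simp: separating_partitions_def)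
    with eq show "P = P'" by (simp add: insert_ident)
  qed
  have inj2: "inj_on extend U"
  proof (rule inj_onI, clarify)
    fix P B P' B' assume U: "(P, B) \<in> U" "(P', B') \<in> U" and eq: "extend (P, B) = extend (P', B')"
    then have part: "partition_on A P" "B \<in> P" "partition_on A P'" "B' \<in> P'"
      by (auto simp: U_def separating_partitions_def)
    note na = notin[OF part(1)] notin[OF part(3)]
    \<comment> \<open>An extended partition has exactly one block containing \<open>a\<close>; it
      determines \<open>B\<close>, and the remaining blocks then determine \<open>P\<close>.\<close>
    have "insert a B \<in> insert (insert a B') (P' - {B'})"
      using eq by (auto simp: extend_def)
    then have "insert a B = insert a B'" using na by auto
    then have B: "B = B'" using na part by (metis insert_ident)
    have "insert a B \<notin> P - {B}" "insert a B \<notin> P' - {B}" using na by auto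
    then have "P - {B} = P' - {B}"
      using eq by (simp add: extend_def B insert_ident)
    with part B show "P = P' \<and> B = B'" by (metis insert_Diff)
  qed
  have "card U = (\<Sum>P\<in>separating_partitions R A (Suc k). card P)"
    unfolding U_def using finP
    by (intro card_SigmaI finite_separating_partitions fin) (auto simp: separating_partitions_def)
  also have "\<dots> = (\<Sum>P\<in>separating_partitions R A (Suc k). Suc k)"
    by (intro sum.cong) (auto simp: separating_partitions_def)
  finally have cardU: "card U = Suc k * card (separating_partitions R A (Suc k))" by simp
  have finU: "finite U"
    unfolding U_def using finP
    by (intro finite_SigmaI finite_separating_partitions fin) (auto simp: separating_partitions_def)
  show ?thesis
    unfolding split
    by (subst card_Un_disjoint[OF _ _ disj])
      (simp_all add: finU finite_separating_partitions fin card_image inj1 inj2 cardU)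
qed

section \<open>Recurrence and boundary values on initial intervals\<close>

lemma card_separated_partitions_Suc:
  assumes "r \<le> N"
  shows "card (separated_partitions (Suc N) (Suc k) r) =
         card (separated_partitions N k r) + Suc k * card (separated_partitions N (Suc k) r)"
proof -
  \<comment> \<open>The fresh element is \<open>Suc N\<close>; \<open>r \<le> N\<close> keeps it
    outside \<open>{1..r}\<close>.\<close>
  have "{1..Suc N} = insert (Suc N) {1..N}" by auto
  then show ?thesis
    unfolding separated_partitions_eq
    using card_separating_partitions_insert[of "{1..N}" "Suc N" "{1..r}" k] assms by simp
qed

lemma card_separated_partitions_eq_0:
  assumes "r \<le> N" "k < r \<or> N < k"
  shows "card (separated_partitions N k r) = 0"
  using assms separating_partitions_empty_if_less[of "{1..N}" "{1..r}" k]
    separating_partitions_empty_if_gt[of "{1..N}" k "{1..r}"]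
  by (auto simp: separated_partitions_eq)

text \<open>The case \<open>m = 0\<close>. In the recurrence the second term vanishes, since it asks
  for more blocks than there are elements.\<close>

lemma card_separated_partitions_max: "card (separated_partitions (n + r) (n + r) r) = 1"
proof (induction n)
  case 0
  show ?case
    using separating_partitions_self[of "{1..r}"] by (simp add: separated_partitions_eq)
next
  case (Suc n)
  then show ?case
    by (simp add: card_separated_partitions_Suc card_separated_partitions_eq_0)
qed

theorem proposition3p6:
  fixes m n r :: nat
  assumes "r > 0"
  shows "poly (box_poly m n) (int r) = int (card (separated_partitions (m + n + r) (n + r) r))"
proof (induction m arbitrary: n)
  case 0
  show ?case by (simp add: box_poly_0 card_separated_partitions_max)
next
  case (Suc m)
  note IHm = Suc
  show ?case
  \<comment> \<open>The recurrence lowers either \<open>m\<close> or \<open>n\<close>, hence the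
    nested induction; the outer hypothesis holds for every \<open>n\<close>.\<close>
  proof (induction n)
    case 0
    \<comment> \<open>Writing \<open>r\<close> as a successor makes the recurrence applicable; its
      first term has only \<open>s < r\<close> blocks and is 0, matching the single term in
      \<open>box_poly_Suc_0\<close>.\<close>
    from assms obtain s where s: "r = Suc s" by (cases r) auto
    have "card (separated_partitions (Suc (m + r)) r r) = r * card (separated_partitions (m + r) r r)"
      using card_separated_partitions_Suc[of r "m + r" s] card_separated_partitions_eq_0[of r "m + r" s]
      by (simp add: s)
    then show ?case using IHm[of 0] by (simp add: box_poly_Suc_0)
  next
    case (Suc n)
    \<comment> \<open>The number of blocks \<open>Suc n + r\<close> is the value at \<open>r\<close>
      of the linear factor in \<open>box_poly_Suc_Suc\<close>.\<close>
    have "card (separated_partitions (Suc m + Suc n + r) (Suc n + r) r) =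
        card (separated_partitions (Suc m + n + r) (n + r) r) +
        (Suc n + r) * card (separated_partitions (m + Suc n + r) (Suc n + r) r)"
      using card_separated_partitions_Suc[of r "Suc m + n + r" "n + r"] by simp
    then show ?case
      using Suc IHm[of "Suc n"] by (simp add: box_poly_Suc_Suc algebra_simps)
  qed
qed

end
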